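(* Let $-\infty\le a<b\le\infty$. Let $g\colon(a,b)\to\mathbb{R}$ be any differentiable function such that $g(x)g'(x)\neq 0$ for each $x\in(a,b)$, let $\rho\colon(a,b)\to\mathbb{R}$ be any (not necessarily strictly) monotonic continuous function, and let $I\subseteq(a,b)$ be any maximal interval of constancy of $\rho$. Then there exists a differentiable function $f\colon(a,b)\to\mathbb{R}$ such that $\dfrac{f'}{g'}=\rho$ on $(a,b)$ and the only maximal interval of constancy of $r:=\dfrac{f}{g}$ is $I$.
   Context: An interval $I\subseteq(a,b)$ is called an interval of constancy of a function $h\colon(a,b)\to\mathbb{R}$ if $I$ has nonzero length and $h$ is constant on $I$. An interval of constancy of $h$ is called maximal if it is not contained in any other interval of constancy of $h$. "Monotonic" means non-decreasing or non-increasing on $(a,b)$. *)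

theory Defs
  imports "HOL-Analysis.Analysis"
begin

text \<open>
  The interval \<open>(a,b)\<close> with possibly infinite endpoints is \<open>einterval a b\<close>. Functions on \<open>(a,b)\<close>
  are total functions on the reals of which only the values on \<open>einterval a b\<close> matter.
\<close>

text \<open>An interval has nonzero length iff it contains two distinct points.\<close>

definition constancy_interval :: "ereal \<Rightarrow> ereal \<Rightarrow> (real \<Rightarrow> real) \<Rightarrow> real set \<Rightarrow> bool" where
  "constancy_interval a b h I \<longleftrightarrow>
     is_interval I \<and> I \<subseteq> einterval a b \<and> (\<exists>x\<in>I. \<exists>y\<in>I. x < y) \<and> h constant_on I"

definition maximal_constancy_interval ::
    "ereal \<Rightarrow> ereal \<Rightarrow> (real \<Rightarrow> real) \<Rightarrow> real set \<Rightarrow> bool" where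
  "maximal_constancy_interval a b h I \<longleftrightarrow>
     constancy_interval a b h I \<and> (\<forall>J. constancy_interval a b h J \<and> I \<subseteq> J \<longrightarrow> J = I)"

end

theory Submission imports Defs begin

text \<open>
  The function \<open>f\<close> must be an antiderivative of \<open>\<rho> g'\<close>, which need not be continuous, so that the
  fundamental theorem of calculus for continuous integrands does not apply to it directly. It applies
  after substitution: \<open>g'\<close> never vanishes, so \<open>g\<close> is a homeomorphism onto an open interval,
  \<open>\<rho> \<circ> g\<inverse>\<close> is continuous there and has an antiderivative \<open>F\<close>, and \<open>f = F \<circ> g\<close>
  up to an additive constant (lemma \<open>antiderivative_wrt\<close>).

  By the quotient rule, \<open>r' = g' (\<rho> g - f) / g\<^sup>2\<close>, so \<open>r'\<close> vanishes exactly where \<open>D = \<rho> g - f\<close>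
  does. Formally \<open>dD = g d\<rho>\<close>; since \<open>g\<close> has constant sign and \<open>\<rho>\<close> is monotonic, \<open>D\<close> is monotonic and
  is constant precisely where \<open>\<rho>\<close> is. Lemma \<open>defect_eq_iff\<close> is this statement with the Stieltjes
  integral replaced by Cauchy's mean value theorem.

  Now \<open>I\<close> is a full level set of \<open>\<rho>\<close>, by monotonicity and maximality. Choosing the additive constant
  of \<open>f\<close> so that \<open>D\<close> is zero at one point of \<open>I\<close> makes \<open>I\<close> the zero set of \<open>D\<close>, hence of \<open>r'\<close>. So
  every interval of constancy of \<open>r\<close> lies in \<open>I\<close>, and on \<open>I\<close> the quotient \<open>r\<close> equals the constant
  value of \<open>\<rho>\<close>.
\<close>

lemma is_interval_einterval: "is_interval (einterval a b)"
  unfolding is_interval_1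
proof (intro ballI allI impI)
  fix x y z assume "x \<in> einterval a b" "y \<in> einterval a b" "x \<le> z \<and> z \<le> y"
  then have "a < ereal x" "ereal x \<le> ereal z" "ereal z \<le> ereal y" "ereal y < b"
    by (auto simp: einterval_iff)
  then show "z \<in> einterval a b"
    by (auto simp: einterval_iff intro: order.strict_trans2[of a "ereal x"]
      order.strict_trans1[of _ "ereal y"])
qed

text \<open>
  An open interval of reals is \<open>einterval l u\<close> for its extended infimum and supremum, and on such
  a set a continuous function has an antiderivative, even if its integral up to an endpoint diverges.
\<close>

lemma open_interval_antiderivative:
  fixes h :: "real \<Rightarrow> real"
  assumes "open T" "is_interval T" "continuous_on T h"
  shows "\<exists>F. \<forall>x\<in>T. (F has_real_derivative h x) (at x)"
proof (cases "T = {}")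
  case False
  define l u where "l = Inf (ereal ` T)" and "u = Sup (ereal ` T)"
  have T_eq: "x \<in> T \<longleftrightarrow> l < ereal x \<and> ereal x < u" for x
  proof
    assume "x \<in> T"
    then obtain e where e: "e > 0" "cball x e \<subseteq> T"
      using \<open>open T\<close> open_contains_cball by blast
    have "x - e \<in> T" "x + e \<in> T" using e by (auto simp: subset_iff dist_real_def)
    then have "l \<le> ereal (x - e)" "ereal (x + e) \<le> u"
      by (auto simp: l_def u_def intro: Inf_lower Sup_upper)
    moreover have "ereal (x - e) < ereal x" "ereal x < ereal (x + e)" using e by auto
    ultimately show "l < ereal x \<and> ereal x < u" by (meson le_less_trans less_le_trans)
  next
    assume "l < ereal x \<and> ereal x < u"
    then obtain p q where "p \<in> T" "p < x" "q \<in> T" "x < q"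
      by (auto simp: l_def u_def Inf_less_iff less_Sup_iff)
    then show "x \<in> T" using \<open>is_interval T\<close> unfolding is_interval_1
      by (meson less_imp_le)
  qed
  have "l < u" using False T_eq by (meson ex_in_conv less_trans)
  moreover have "isCont h x" if "l < ereal x" "ereal x < u" for x
    using that T_eq assms continuous_on_eq_continuous_at by blast
  ultimately show ?thesis
    using einterval_antiderivative[of l u h] T_eq
    by (auto simp: has_real_derivative_iff_has_vector_derivative)
qed simp

text \<open>
  Taking \<open>g\<close> as the new variable turns \<open>\<rho> g'\<close>, which may be discontinuous, into the continuous
  function \<open>\<rho> \<circ> g\<inverse>\<close>.
\<close>

lemma antiderivative_wrt:
  fixes g g' \<rho> :: "real \<Rightarrow> real"
  assumes S: "open S" "is_interval S"
    and g: "\<And>x. x \<in> S \<Longrightarrow> (g has_real_derivative g' x) (at x)"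
    and nz: "\<And>x. x \<in> S \<Longrightarrow> g' x \<noteq> 0"
    and \<rho>: "continuous_on S \<rho>"
  shows "\<exists>f. \<forall>x\<in>S. (f has_real_derivative \<rho> x * g' x) (at x)"
proof -
  have contg: "continuous_on S g"
    using g by (meson DERIV_isCont continuous_at_imp_continuous_on)
  have "g x \<noteq> g y" if "x \<in> S" "y \<in> S" "x < y" for x y
  proof
    assume "g x = g y"
    have sub: "z \<in> S" if "x \<le> z" "z \<le> y" for z
      using S(2) \<open>x \<in> S\<close> \<open>y \<in> S\<close> that unfolding is_interval_1 by blast
    obtain z where "x < z" "z < y" "g y - g x = (y - x) * g' z"
      using MVT2[of x y g g'] \<open>x < y\<close> sub g by blast
    then show False using \<open>g x = g y\<close> nz[of z] sub[of z] by auto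
  qed
  then have inj: "inj_on g S" by (metis linorder_inj_onI linear)
  obtain h where h: "homeomorphism S (g ` S) g h"
    using invariance_of_domain_homeomorphism[OF S(1) contg _ inj] by auto
  have opn: "open (g ` S)" by (rule invariance_of_domain[OF contg S(1) inj])
  have "is_interval (g ` S)"
    using S(2) contg connected_continuous_image is_interval_connected_1 by blast
  moreover have "continuous_on (g ` S) (\<rho> \<circ> h)"
    using h \<rho> by (intro continuous_on_compose) (auto simp: homeomorphism_def)
  ultimately obtain F where F: "\<And>y. y \<in> g ` S \<Longrightarrow> (F has_real_derivative (\<rho> \<circ> h) y) (at y)"
    using open_interval_antiderivative[OF opn] by blast
  have "((\<lambda>x. F (g x)) has_real_derivative \<rho> x * g' x) (at x)" if "x \<in> S" for x
    using DERIV_chain2[OF F[of "g x"] g[OF that]] that h by (simp add: homeomorphism_def)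
  then show ?thesis by blast
qed

text \<open>
  For \<open>x < y\<close>, Cauchy's mean value theorem gives \<open>z\<close> between them with
  \<open>f y - f x = \<rho> z (g y - g x)\<close>. The increment of \<open>\<rho> g - f\<close> is then
  \<open>(\<rho> y - \<rho> z) g y + (\<rho> z - \<rho> x) g x\<close>. As \<open>g\<close> has no zero, \<open>g x\<close> and \<open>g y\<close> have the
  same sign, so the two summands do not have opposite signs, and their sum can vanish only if both do.
\<close>

lemma defect_eq_iff:
  fixes f g g' \<rho> :: "real \<Rightarrow> real"
  assumes S: "is_interval S"
    and g: "\<And>x. x \<in> S \<Longrightarrow> (g has_real_derivative g' x) (at x)"
    and f: "\<And>x. x \<in> S \<Longrightarrow> (f has_real_derivative \<rho> x * g' x) (at x)"
    and nz: "\<And>x. x \<in> S \<Longrightarrow> g x \<noteq> 0" "\<And>x. x \<in> S \<Longrightarrow> g' x \<noteq> 0"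
    and mono: "mono_on S \<rho> \<or> antimono_on S \<rho>"
    and xy: "x \<in> S" "y \<in> S"
  shows "\<rho> x * g x - f x = \<rho> y * g y - f y \<longleftrightarrow> \<rho> x = \<rho> y"
proof -
  have main: "\<rho> x * g x - f x = \<rho> y * g y - f y \<longleftrightarrow> \<rho> x = \<rho> y"
    if "x \<in> S" "y \<in> S" "x < y" for x y
  proof -
    have sub: "z \<in> S" if "x \<le> z" "z \<le> y" for z
      using S \<open>x \<in> S\<close> \<open>y \<in> S\<close> that unfolding is_interval_1 by blast
    obtain z where z: "x < z" "z < y"
      and "(f y - f x) * g' z = (g y - g x) * (\<rho> z * g' z)"
      using GMVT'[of x y f g g' "\<lambda>z. \<rho> z * g' z"] \<open>x < y\<close> DERIV_isCont[OF f[OF sub]]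
        DERIV_isCont[OF g[OF sub]] f[OF sub] g[OF sub]
      by (auto simp: less_imp_le)
    then have fy: "f y - f x = \<rho> z * (g y - g x)"
      using nz(2)[of z] sub[of z] by auto
    have "z \<in> S" using z sub by simp
    define p q where "p = (\<rho> y - \<rho> z) * g y" and "q = (\<rho> z - \<rho> x) * g x"
    have diff: "(\<rho> y * g y - f y) - (\<rho> x * g x - f x) = p + q"
      using fy by (simp add: p_def q_def algebra_simps)
    have "continuous_on {x..y} g"
      using DERIV_isCont[OF g[OF sub]] by (simp add: continuous_at_imp_continuous_on)
    then have gpos: "g x * g y > 0"
    proof -
      have "g z \<noteq> 0" if "x \<le> z" "z \<le> y" for z
        using nz(1) sub that by blast
      then have "\<not> (g x \<le> 0 \<and> 0 \<le> g y)" "\<not> (g y \<le> 0 \<and> 0 \<le> g x)"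
        using IVT'[of g x 0 y] IVT2'[of g y 0 x] \<open>continuous_on {x..y} g\<close> \<open>x < y\<close>
        by auto
      then show ?thesis by (auto simp: zero_less_mult_iff)
    qed
    have rpos: "(\<rho> y - \<rho> z) * (\<rho> z - \<rho> x) \<ge> 0"
      using mono
    proof
      assume "mono_on S \<rho>"
      then have "\<rho> x \<le> \<rho> z" "\<rho> z \<le> \<rho> y"
        using z that \<open>z \<in> S\<close> by (auto simp: monotone_on_def)
      then show ?thesis by simp
    next
      assume "antimono_on S \<rho>"
      then have "\<rho> z \<le> \<rho> x" "\<rho> y \<le> \<rho> z"
        using z that \<open>z \<in> S\<close> by (auto simp: monotone_on_def)
      then show ?thesis by (simp add: mult_nonpos_nonpos)
    qed
    have "p * q = ((\<rho> y - \<rho> z) * (\<rho> z - \<rho> x)) * (g x * g y)"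
      by (simp add: p_def q_def)
    then have pq: "p * q \<ge> 0" using rpos gpos by simp
    show ?thesis
    proof
      assume "\<rho> x * g x - f x = \<rho> y * g y - f y"
      then have "p = - q" using diff by simp
      then have "q = 0" "p = 0" using pq by (auto simp: mult_le_0_iff)
      then show "\<rho> x = \<rho> y"
        using nz(1) that by (simp add: p_def q_def)
    next
      assume eq: "\<rho> x = \<rho> y"
      then have "\<rho> z = \<rho> x" using rpos
        by (smt (verit) mult_pos_neg mult_neg_pos)
      then show "\<rho> x * g x - f x = \<rho> y * g y - f y"
        using diff eq by (simp add: p_def q_def)
    qed
  qed
  show ?thesis
  proof (cases x y rule: linorder_cases)
    case less
    then show ?thesis by (rule main[OF xy])
  next
    case greater
    then show ?thesis using main[OF xy(2) xy(1)] by metis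
  qed simp
qed

text \<open>
  Level sets of a monotonic function are intervals; a maximal interval of constancy cannot be a
  proper part of the level set that contains it.
\<close>

lemma maximal_constancy_interval_level_set:
  assumes mono: "mono_on (einterval a b) \<rho> \<or> antimono_on (einterval a b) \<rho>"
    and I: "maximal_constancy_interval a b \<rho> I" and c: "c \<in> I"
  shows "I = {x \<in> einterval a b. \<rho> x = \<rho> c}"
proof -
  define L where "L = {x \<in> einterval a b. \<rho> x = \<rho> c}"
  have I': "constancy_interval a b \<rho> I"
    using I by (simp add: maximal_constancy_interval_def)
  then have "I \<subseteq> L"
    using c by (auto simp: L_def constancy_interval_def constant_on_def)
  have "is_interval L"
    unfolding is_interval_1
  proof (intro ballI allI impI)
    fix x y z assume xyz: "x \<in> L" "y \<in> L" "x \<le> z \<and> z \<le> y"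
    have "z \<in> einterval a b"
      using xyz is_interval_einterval[of a b] unfolding L_def is_interval_1 by blast
    then show "z \<in> L"
      using mono xyz by (auto simp: L_def monotone_on_def) (metis order_antisym)+
  qed
  then have "constancy_interval a b \<rho> L"
    using I' \<open>I \<subseteq> L\<close> unfolding constancy_interval_def
    by (auto simp: constant_on_def L_def)
  then show ?thesis
    using I \<open>I \<subseteq> L\<close> unfolding maximal_constancy_interval_def L_def by blast
qed

text \<open>
  The point \<open>x\<close> may be an endpoint of \<open>J\<close>: a one-sided derivative already determines \<open>d\<close>.
\<close>

lemma deriv_zero_of_constant_on_interval:
  fixes r :: "real \<Rightarrow> real"
  assumes "is_interval J" "u \<in> J" "v \<in> J" "u < v" "r constant_on J" "x \<in> J"
    and r: "(r has_real_derivative d) (at x)"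
  shows "d = 0"
proof -
  obtain k where k: "\<And>y. y \<in> J \<Longrightarrow> r y = k"
    using assms(5) by (auto simp: constant_on_def)
  have "x islimpt J"
    using assms connected_imp_perfect[of J x]
    by (metis is_interval_connected_1 less_irrefl singletonD)
  then have "at x within J \<noteq> bot"
    by (simp add: trivial_limit_within)
  moreover have "(r has_real_derivative d) (at x within J)"
    using r by (rule has_field_derivative_at_within)
  moreover have "(r has_real_derivative 0) (at x within J)"
    by (rule has_field_derivative_transform_within[OF DERIV_const, of 1 x J k])
      (use k assms in auto)
  ultimately show ?thesis
    by (meson has_field_derivative_iff tendsto_unique)
qed

theorem proposition3:
  fixes a b :: ereal and g \<rho> :: "real \<Rightarrow> real" and I :: "real set"
  assumes "a < b"
    and "g differentiable_on einterval a b"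
    and "\<forall>x\<in>einterval a b. g x * deriv g x \<noteq> 0"
    and "mono_on (einterval a b) \<rho> \<or> antimono_on (einterval a b) \<rho>"
    and "continuous_on (einterval a b) \<rho>"
    and "maximal_constancy_interval a b \<rho> I"
  shows "\<exists>f :: real \<Rightarrow> real. f differentiable_on einterval a b \<and>
           (\<forall>x\<in>einterval a b. deriv f x / deriv g x = \<rho> x) \<and>
           (\<forall>J. maximal_constancy_interval a b (\<lambda>x. f x / g x) J \<longleftrightarrow> J = I)"
proof -
  define S where "S = einterval a b"
  have S: "open S" "is_interval S"
    by (simp_all add: S_def is_interval_einterval)
  have I: "is_interval I" "I \<subseteq> S" "\<exists>x\<in>I. \<exists>y\<in>I. x < y"
    using assms(6) by (auto simp: maximal_constancy_interval_def constancy_interval_def S_def)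
  have nz: "g x \<noteq> 0" "deriv g x \<noteq> 0" if "x \<in> S" for x
    using assms(3) that by (auto simp: S_def)
  have g: "(g has_real_derivative deriv g x) (at x)" if "x \<in> S" for x
    using assms(2) that S
    by (metis S_def DERIV_deriv_iff_real_differentiable differentiable_on_eq_differentiable_at)
  obtain c where c: "c \<in> I" using I(3) by blast
  obtain f0 where f0: "\<And>x. x \<in> S \<Longrightarrow> (f0 has_real_derivative \<rho> x * deriv g x) (at x)"
    using antiderivative_wrt[OF S g nz(2)] assms(5) unfolding S_def by blast
  \<comment> \<open>The constant is chosen so that \<open>\<rho> g - f\<close> vanishes at \<open>c\<close>.\<close>
  define f where "f x = f0 x + (\<rho> c * g c - f0 c)" for x
  have f: "(f has_real_derivative \<rho> x * deriv g x) (at x)" if "x \<in> S" for x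
    unfolding f_def using f0[OF that] by (auto intro!: derivative_eq_intros)
  have I_eq: "I = {x \<in> S. \<rho> x = \<rho> c}"
    using maximal_constancy_interval_level_set[OF assms(4,6) c] by (simp add: S_def)
  have zero: "\<rho> x * g x - f x = 0 \<longleftrightarrow> x \<in> I" if "x \<in> S" for x
    using defect_eq_iff[OF S(2) g f nz, of x c] assms(4) that c I(2) I_eq
    by (auto simp: S_def f_def)
  have r: "((\<lambda>x. f x / g x) has_real_derivative
             deriv g x * (\<rho> x * g x - f x) / (g x)\<^sup>2) (at x)" if "x \<in> S" for x
    using f[OF that] g[OF that] nz(1)[OF that]
    by (auto intro!: derivative_eq_intros simp: power2_eq_square algebra_simps)
  have r_const: "constancy_interval a b (\<lambda>x. f x / g x) I"
  proof -
    have "f x / g x = \<rho> c" if "x \<in> I" for x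
      using zero[of x] that I_eq nz(1)[of x] by (auto simp: field_simps)
    then show ?thesis using I by (auto simp: constancy_interval_def S_def constant_on_def)
  qed
  have sub_I: "J \<subseteq> I" if J: "constancy_interval a b (\<lambda>x. f x / g x) J" for J
  proof
    fix x assume "x \<in> J"
    obtain u v where uv: "u \<in> J" "v \<in> J" "u < v"
      using J by (auto simp: constancy_interval_def)
    have "x \<in> S" using J \<open>x \<in> J\<close> by (auto simp: constancy_interval_def S_def)
    have "deriv g x * (\<rho> x * g x - f x) / (g x)\<^sup>2 = 0"
      using deriv_zero_of_constant_on_interval[OF _ uv _ \<open>x \<in> J\<close> r[OF \<open>x \<in> S\<close>]] J
      by (auto simp: constancy_interval_def)
    then show "x \<in> I" using zero nz \<open>x \<in> S\<close> by auto
  qed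
  have "maximal_constancy_interval a b (\<lambda>x. f x / g x) J \<longleftrightarrow> J = I" for J
    unfolding maximal_constancy_interval_def using r_const sub_I by blast
  moreover have "f differentiable_on S"
    using f S(1) real_differentiable_def by (auto simp: differentiable_on_eq_differentiable_at)
  moreover have "deriv f x / deriv g x = \<rho> x" if "x \<in> S" for x
    using DERIV_imp_deriv[OF f[OF that]] nz(2)[OF that] by simp
  ultimately show ?thesis unfolding S_def by blast
qed

end
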